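(* Let $T>0$ and let $A:\mathbb{R}\to\mathbb{H}^{n\times n}$ be continuous and $T$-periodic. If $M(t)$ is a fundamental matrix of $\dot{\boldsymbol{x}}=A(t)\boldsymbol{x}$, then $$M(t+T)=M(t)M^{-1}(0)M(T)\quad\text{for all } t.$$ In addition, $M(t)$ has the form $$M(t)=P(t)e^{tB},$$ where $P(t)$ is a $T$-periodic quaternion-matrix-valued function and $B\in\mathbb{H}^{n\times n}$ satisfies $$e^{TB}=M^{-1}(0)M(T).$$
   Context: $\mathbb{H}$ is the real quaternion algebra. For $A\in\mathbb{H}^{n\times n}$, $e^{A}=\exp(A)=\sum_{m\ge 0}A^m/m!$. Unknowns $\boldsymbol{x}(t)$ take values in $\mathbb{H}^n$ (column vectors), regarded as a right $\mathbb{H}$-module. A fundamental matrix of $\dot{\boldsymbol{x}}=A(t)\boldsymbol{x}$ is an $\mathbb{H}^{n\times n}$-valued solution $M(t)$ of $\dot M=A(t)M$ whose columns are right linearly independent solutions (equivalently, $M(t)$ is invertible for every $t$). *)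

theory Defs
  imports "HOL-Analysis.Analysis"
begin

section \<open>The real quaternion algebra\<close>

text \<open>\<open>Quat a b c d\<close> is \<open>a + b i + c j + d k\<close>.\<close>

datatype quat = Quat (q0: real) (q1: real) (q2: real) (q3: real)

lemma quat_eq_iff: "x = y \<longleftrightarrow> q0 x = q0 y \<and> q1 x = q1 y \<and> q2 x = q2 y \<and> q3 x = q3 y"
  by (cases x; cases y) auto

instantiation quat :: real_vector
begin

definition "0 = Quat 0 0 0 0"
definition "x + y = Quat (q0 x + q0 y) (q1 x + q1 y) (q2 x + q2 y) (q3 x + q3 y)"
definition "- x = Quat (- q0 x) (- q1 x) (- q2 x) (- q3 x)"
definition "x - y = Quat (q0 x - q0 y) (q1 x - q1 y) (q2 x - q2 y) (q3 x - q3 y)"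
definition "r *\<^sub>R x = Quat (r * q0 x) (r * q1 x) (r * q2 x) (r * q3 x)"

instance
  by standard
    (simp_all add: zero_quat_def plus_quat_def uminus_quat_def minus_quat_def
      scaleR_quat_def distrib_left distrib_right)

end

instantiation quat :: real_inner
begin

definition "inner x y = q0 x * q0 y + q1 x * q1 y + q2 x * q2 y + q3 x * q3 y"
definition "norm x = sqrt ((q0 x)\<^sup>2 + (q1 x)\<^sup>2 + (q2 x)\<^sup>2 + (q3 x)\<^sup>2)" for x :: quat
definition "sgn x = x /\<^sub>R norm x" for x :: quat
definition "dist x y = norm (x - y)" for x y :: quat
definition [code del]:
  "(uniformity :: (quat \<times> quat) filter) = (INF e\<in>{0 <..}. principal {(x, y). dist x y < e})"
definition [code del]:
  "open (U :: quat set) \<longleftrightarrow>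
    (\<forall>x\<in>U. eventually (\<lambda>(x', y). x' = x \<longrightarrow> y \<in> U) uniformity)"

instance
proof
  fix x y z :: quat and r :: real
  show "inner x y = inner y x"
    by (simp add: inner_quat_def mult.commute)
  show "inner (x + y) z = inner x z + inner y z"
    by (simp add: inner_quat_def plus_quat_def algebra_simps)
  show "inner (r *\<^sub>R x) y = r * inner x y"
    by (simp add: inner_quat_def scaleR_quat_def algebra_simps)
  show "0 \<le> inner x x"
    by (simp add: inner_quat_def)
  show "inner x x = 0 \<longleftrightarrow> x = 0"
    by (auto simp: inner_quat_def quat_eq_iff zero_quat_def add_nonneg_eq_0_iff)
  show "norm x = sqrt (inner x x)"
    by (simp add: inner_quat_def norm_quat_def power2_eq_square)
qed (rule sgn_quat_def dist_quat_def uniformity_quat_def open_quat_def)+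

end

instantiation quat :: euclidean_space
begin

definition "Basis = {Quat 1 0 0 0, Quat 0 1 0 0, Quat 0 0 1 0, Quat 0 0 0 1}"

instance
proof
  fix u v :: quat
  show "inner u v = (if u = v then 1 else 0)" if "u \<in> Basis" "v \<in> Basis"
    using that unfolding Basis_quat_def by (elim insertE emptyE) (simp_all add: inner_quat_def)
  show "(\<forall>w\<in>Basis. inner u w = 0) \<longleftrightarrow> u = 0"
    by (cases u) (simp add: Basis_quat_def inner_quat_def zero_quat_def)
qed (simp_all add: Basis_quat_def)

end

instantiation quat :: real_normed_div_algebra
begin

definition "1 = Quat 1 0 0 0"

definition "x * y = Quat
  (q0 x * q0 y - q1 x * q1 y - q2 x * q2 y - q3 x * q3 y)
  (q0 x * q1 y + q1 x * q0 y + q2 x * q3 y - q3 x * q2 y)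
  (q0 x * q2 y - q1 x * q3 y + q2 x * q0 y + q3 x * q1 y)
  (q0 x * q3 y + q1 x * q2 y - q2 x * q1 y + q3 x * q0 y)"

definition "inverse x =
  Quat (q0 x) (- q1 x) (- q2 x) (- q3 x) /\<^sub>R ((q0 x)\<^sup>2 + (q1 x)\<^sup>2 + (q2 x)\<^sup>2 + (q3 x)\<^sup>2)"

definition "x div y = x * inverse y" for x y :: quat

instance
proof
  fix x y z :: quat and r :: real
  show "norm (x * y) = norm x * norm y"
    unfolding norm_quat_def times_quat_def real_sqrt_mult [symmetric]
    by (simp add: power2_eq_square algebra_simps)
  have inv: "x * inverse x = 1 \<and> inverse x * x = 1" if "x \<noteq> 0"
  proof -
    define N where "N = (q0 x)\<^sup>2 + (q1 x)\<^sup>2 + (q2 x)\<^sup>2 + (q3 x)\<^sup>2"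
    have "N \<noteq> 0"
      using that by (auto simp: N_def zero_quat_def quat_eq_iff add_nonneg_eq_0_iff)
    moreover have "inverse x = Quat (q0 x / N) (- q1 x / N) (- q2 x / N) (- q3 x / N)"
      by (simp add: inverse_quat_def scaleR_quat_def N_def divide_inverse mult.commute)
    ultimately show ?thesis
      by (auto simp: times_quat_def one_quat_def field_simps)
         (auto simp: N_def power2_eq_square)
  qed
  show "x \<noteq> 0 \<Longrightarrow> inverse x * x = 1" "x \<noteq> 0 \<Longrightarrow> x * inverse x = 1"
    using inv by auto
  show "x div y = x * inverse y"
    by (rule divide_quat_def)
  show "inverse (0 :: quat) = 0"
    by (simp add: inverse_quat_def zero_quat_def scaleR_quat_def)
  show "x * y * z = x * (y * z)"
    by (simp add: times_quat_def algebra_simps)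
  show "(x + y) * z = x * z + y * z" "x * (y + z) = x * y + x * z"
    by (simp_all add: times_quat_def plus_quat_def algebra_simps)
  show "1 * x = x" "x * 1 = x" "(0 :: quat) \<noteq> 1"
    by (simp_all add: times_quat_def one_quat_def zero_quat_def)
  show "r *\<^sub>R x * y = r *\<^sub>R (x * y)" "x * r *\<^sub>R y = r *\<^sub>R (x * y)"
    by (simp_all add: times_quat_def scaleR_quat_def algebra_simps)
qed

end

lemma hamilton_relations:
  fixes i j k :: quat
  defines "i \<equiv> Quat 0 1 0 0" and "j \<equiv> Quat 0 0 1 0" and "k \<equiv> Quat 0 0 0 1"
  shows "i * i = -1" "j * j = -1" "k * k = -1"
    "i * j = k" "j * k = i" "k * i = j" "j * i = - k" "k * j = - i" "i * k = - j"
  by (auto simp: assms quat_eq_iff times_quat_def one_quat_def uminus_quat_def)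

section \<open>Quaternionic matrices and linear differential systems\<close>

definition mexp :: "quat^'n^'n \<Rightarrow> quat^'n^'n" where
  "mexp A = (\<Sum>m. ((**) A ^^ m) (mat 1) /\<^sub>R fact m)"

definition right_scale :: "quat^'n \<Rightarrow> quat \<Rightarrow> quat^'n" where
  "right_scale v c = (\<chi> i. v $ i * c)"

text \<open>Independence of a family of vector-valued functions as functions, i.e. with constant
  quaternion coefficients acting from the right.\<close>

definition right_lin_indep :: "('j::finite \<Rightarrow> real \<Rightarrow> quat^'n) \<Rightarrow> bool" where
  "right_lin_indep x \<longleftrightarrow>
    (\<forall>c. (\<forall>t. (\<Sum>j\<in>UNIV. right_scale (x j t) (c j)) = 0) \<longrightarrow> (\<forall>j. c j = 0))"

definition is_solution :: "(real \<Rightarrow> quat^'n^'n) \<Rightarrow> (real \<Rightarrow> quat^'n) \<Rightarrow> bool" where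
  "is_solution A x \<longleftrightarrow> (\<forall>t. (x has_vector_derivative A t *v x t) (at t))"

definition fundamental_matrix :: "(real \<Rightarrow> quat^'n^'n) \<Rightarrow> (real \<Rightarrow> quat^'n^'n) \<Rightarrow> bool" where
  "fundamental_matrix A M \<longleftrightarrow>
    (\<forall>t. (M has_vector_derivative A t ** M t) (at t)) \<and>
    (\<forall>j. is_solution A (\<lambda>t. column j (M t))) \<and>
    right_lin_indep (\<lambda>j t. column j (M t))"

end

theory Submission
  imports Defs
begin

text \<open>
  Write \<open>C = M(0)\<^sup>-\<^sup>1 M(T)\<close>. Because \<open>A\<close> is \<open>T\<close>-periodic, \<open>t \<mapsto> M(t + T)\<close> and
  \<open>t \<mapsto> M(t) C\<close> solve the same linear equation and agree at \<open>t = 0\<close>, so they coincide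
  (\<open>linear_ode_unique_zero\<close>). The same uniqueness shows that every \<open>M(t)\<close> is injective: a
  vector annihilated by one \<open>M(t)\<close> is annihilated by all of them, and this is a linear relation
  between the columns. Once a matrix \<open>B\<close> with \<open>e\<^sup>T\<^sup>B = C\<close> is found, \<open>P(t) = M(t) e\<^sup>-\<^sup>t\<^sup>B\<close> is
  periodic. The substance is therefore that every invertible quaternionic matrix has a
  logarithm (\<open>quat_matrix_log_exists\<close>), in contrast with real matrices.

  If \<open>C\<close> has no spectrum on the half-line \<open>(-\<infinity>, 0]\<close>, then \<open>1 + s (C - 1)\<close> is invertible for
  \<open>0 \<le> s \<le> 1\<close>, and the integral of \<open>(C - 1) (1 + s (C - 1))\<^sup>-\<^sup>1\<close> over \<open>[0, 1]\<close> is a logarithm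
  that commutes with everything commuting with \<open>C\<close> (\<open>log_exists_if_segment_invertible\<close>).

  The negative eigenvalues are removed by a rotation. Let \<open>V\<close> be the sum of the generalized
  eigenspaces of \<open>C\<close> for its negative eigenvalues. On \<open>V\<close> there is a quaternion-linear \<open>K\<close> with
  \<open>K\<^sup>2 = -1\<close> that commutes with \<open>C\<close>. Extended by \<open>0\<close> to a complement of \<open>V\<close>, it satisfies
  \<open>e\<^sup>\<pi>\<^sup>K = 1 + 2 K\<^sup>2\<close>, which is \<open>-1\<close> on \<open>V\<close> and \<open>1\<close> on the complement, so \<open>C e\<^sup>\<pi>\<^sup>K\<close> has no
  spectrum on \<open>(-\<infinity>, 0]\<close>. Adding \<open>\<pi> K\<close> to the logarithm of that operator gives one of \<open>C\<close>,
  because \<open>e\<^sup>\<pi>\<^sup>K\<close> is an involution.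

  Such a \<open>K\<close> amounts to a complex subspace \<open>U\<close> of \<open>V\<close> with \<open>C U \<subseteq> U\<close> and \<open>V = U \<oplus> U j\<close>, on which
  \<open>K\<close> is right multiplication by \<open>i\<close>; over the quaternions, a Jordan basis would give one. It is
  built by induction on the number of factors of a real polynomial \<open>\<Prod>(x - \<lambda>)\<close> annihilating \<open>C\<close>
  on \<open>V\<close>: a subspace \<open>U'\<close> that works for \<open>(C - \<lambda>) V\<close> is enlarged to one for \<open>V\<close>, and any complex
  subspace lying between \<open>U'\<close> and its preimage under \<open>C - \<lambda>\<close> is automatically \<open>C\<close>-invariant
  (\<open>half_of_split_submodule\<close>).

  The exponential is studied in the Banach algebra of bounded real-linear operators on
  \<open>H^n\<close>. In it, the left multiplications by matrices are exactly the operators that commute with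
  the right multiplications by \<open>i\<close> and \<open>j\<close>.
\<close>

section \<open>Logarithms in Banach algebras\<close>

lemma exp_commutes_with_commuting:
  fixes x y :: "'a::{real_normed_algebra_1,banach}"
  assumes "x * y = y * x"
  shows "exp x * y = y * exp x"
proof -
  have "exp x * y = (\<Sum>n. (x ^ n /\<^sub>R fact n) * y)"
    unfolding exp_def by (rule suminf_mult2 [OF summable_exp_generic])
  also have "\<dots> = (\<Sum>n. y * (x ^ n /\<^sub>R fact n))"
    using power_commuting_commutes [OF assms] by simp
  also have "\<dots> = y * exp x"
    unfolding exp_def by (rule suminf_mult [OF summable_exp_generic])
  finally show ?thesis .
qed

lemma exp_has_derivative_at_zero:
  "(exp has_derivative (\<lambda>h. h)) (at (0::'a::{real_normed_algebra_1,banach}))"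
proof (rule has_derivativeI_sandwich[where e=1 and H=norm])
  fix y :: 'a
  assume y: "y \<noteq> 0" "dist y 0 < 1"
  have sum: "summable (\<lambda>n. inverse (fact (n + 2)) *\<^sub>R (norm y ^ (n + 2)))"
    using summable_ignore_initial_segment [OF summable_exp_generic [of "norm y"], of 2] by simp
  have "exp y - 1 - y = (\<Sum>n. inverse (fact (n + 2)) *\<^sub>R (y ^ (n + 2)))"
    by (subst exp_first_two_terms) simp
  also have "norm \<dots> \<le> (\<Sum>n. inverse (fact (n + 2)) *\<^sub>R (norm y ^ (n + 2)))"
  proof (rule norm_suminf_le [OF _ sum])
    show "norm (inverse (fact (n + 2)) *\<^sub>R y ^ (n + 2))
      \<le> inverse (fact (n + 2)) *\<^sub>R norm y ^ (n + 2)" for n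
      using norm_power_ineq[of y "n + 2"] by (simp add: mult_left_mono)
  qed
  also have "\<dots> = exp (norm y) - 1 - norm y"
    by (subst exp_first_two_terms) simp
  also have "\<dots> \<le> (norm y)\<^sup>2"
    using exp_bound[of "norm y"] y by simp
  finally show "norm (exp y - exp 0 - (y - 0)) / norm (y - 0) \<le> norm y"
    using y by (simp add: divide_simps power2_eq_square diff_diff_eq)
next
  show "(norm \<longlongrightarrow> 0) (at (0::'a))"
    using tendsto_norm[OF tendsto_ident_at, of "0::'a" UNIV] by simp
qed auto

text \<open>
  Without commutativity the derivative of \<open>exp (L t)\<close> has no such closed form; here
  \<open>exp (L s) = exp (L t) exp (L s - L t)\<close> reduces it to the derivative of \<open>exp\<close> at \<open>0\<close>.
\<close>

lemma exp_has_vector_derivative_commuting_path: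
  fixes L :: "real \<Rightarrow> 'a::{real_normed_algebra_1,banach}"
  assumes deriv: "(L has_vector_derivative L') (at t within S)"
    and comm: "\<And>s. L s * L t = L t * L s"
  shows "((\<lambda>s. exp (L s)) has_vector_derivative exp (L t) * L') (at t within S)"
proof -
  have "((\<lambda>s. L s - L t) has_derivative (\<lambda>h. h *\<^sub>R L')) (at t within S)"
    using has_vector_derivative_diff_const [THEN iffD2, OF deriv]
    by (simp add: has_vector_derivative_def)
  then have "((\<lambda>s. exp (L s - L t)) has_derivative (\<lambda>h. h *\<^sub>R L')) (at t within S)"
    by (rule has_derivative_compose) (simp add: exp_has_derivative_at_zero)
  then have "((\<lambda>s. exp (L s - L t)) has_vector_derivative L') (at t within S)"
    by (simp add: has_vector_derivative_def)
  then have "((\<lambda>s. exp (L t) * exp (L s - L t)) has_vector_derivative exp (L t) * L') (at t within S)"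
    by (rule has_vector_derivative_mult_right)
  moreover have "exp (L t) * exp (L s - L t) = exp (L s)" for s
    using exp_add_commuting [of "L t" "L s - L t"] comm [of s]
    by (simp add: right_diff_distrib left_diff_distrib)
  ultimately show ?thesis by simp
qed

lemma continuous_on_inverse_path:
  fixes f R :: "real \<Rightarrow> 'a::real_normed_algebra_1"
  assumes cont: "continuous_on S f"
    and inv: "\<And>s. s \<in> S \<Longrightarrow> R s * f s = 1" "\<And>s. s \<in> S \<Longrightarrow> f s * R s = 1"
  shows "continuous_on S R"
  unfolding continuous_on_def
proof
  fix t assume t: "t \<in> S"
  (* By the resolvent identity R s - R t = - R s (f s - f t) R t, it is enough to bound R s
     near t; the same identity does so as soon as \<delta> s < 1/2. *)
  define \<delta> where "\<delta> s = norm (f s - f t) * norm (R t)" for s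
  have lim: "(\<delta> \<longlongrightarrow> 0) (at t within S)"
    unfolding \<delta>_def
    using tendsto_mult_right [OF tendsto_norm [OF LIM_zero [OF cont [unfolded continuous_on_def, rule_format, OF t]]],
        of "norm (R t)"]
    by simp
  then have small: "\<forall>\<^sub>F s in at t within S. \<delta> s < 1 / 2"
    by (rule order_tendstoD) simp
  have bound: "norm (R s - R t) \<le> 2 * norm (R t) * \<delta> s" if s: "s \<in> S" "\<delta> s < 1 / 2" for s
  proof -
    have "R s - R t = - (R s * (f s - f t) * R t)"
      using inv(1)[OF s(1)] inv(2)[OF t] by (simp add: algebra_simps)
    then have "norm (R s - R t) \<le> norm (R s * (f s - f t)) * norm (R t)"
      by (simp add: norm_mult_ineq)
    also have "\<dots> \<le> norm (R s) * norm (f s - f t) * norm (R t)"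
      by (intro mult_right_mono norm_mult_ineq norm_ge_zero)
    finally have diff: "norm (R s - R t) \<le> norm (R s) * \<delta> s"
      by (simp add: \<delta>_def mult.assoc)
    have "norm (R s) \<le> norm (R s - R t) + norm (R t)"
      using norm_triangle_ineq[of "R s - R t" "R t"] by simp
    also have "\<dots> \<le> norm (R s) * (1/2) + norm (R t)"
      using diff s(2) mult_left_mono[of "\<delta> s" "1/2" "norm (R s)"] by simp
    finally have "norm (R s) \<le> 2 * norm (R t)" by simp
    moreover have "0 \<le> \<delta> s" by (simp add: \<delta>_def)
    ultimately show ?thesis
      using diff mult_right_mono[of "norm (R s)" "2 * norm (R t)" "\<delta> s"] by linarith
  qed
  have "((\<lambda>s. R s - R t) \<longlongrightarrow> 0) (at t within S)"
  proof (rule Lim_null_comparison)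
    show "\<forall>\<^sub>F s in at t within S. norm (R s - R t) \<le> 2 * norm (R t) * \<delta> s"
      using small eventually_at_filter[of "\<lambda>s. s \<in> S" t S] bound
      by (auto simp: eventually_at_filter elim!: eventually_mono)
    show "((\<lambda>s. 2 * norm (R t) * \<delta> s) \<longlongrightarrow> 0) (at t within S)"
      using tendsto_mult_left [OF lim, of "2 * norm (R t)"] by simp
  qed
  then show "(R \<longlongrightarrow> R t) (at t within S)"
    by (rule LIM_zero_cancel)
qed

text \<open>
  The integral of \<open>f' f\<^sup>-\<^sup>1\<close> along the segment \<open>f s = 1 + s (c - 1)\<close> from \<open>1\<close> to \<open>c\<close>, as in the
  scalar formula for the logarithm. All operators involved are limits of expressions in \<open>c\<close>, hence
  commute with each other, and so \<open>exp (- L t) f t\<close> has derivative zero.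
\<close>

proposition log_exists_if_segment_invertible:
  fixes c :: "'a::{real_normed_algebra_1,banach}"
  assumes inv: "\<And>s. s \<in> {0..1} \<Longrightarrow>
      \<exists>r. r * (1 + s *\<^sub>R (c - 1)) = 1 \<and> (1 + s *\<^sub>R (c - 1)) * r = 1"
  obtains L where "exp L = c" "\<And>x. x * c = c * x \<Longrightarrow> x * L = L * x"
proof -
  define f where "f s = 1 + s *\<^sub>R (c - 1)" for s
  obtain R where R: "\<And>s. s \<in> {0..1} \<Longrightarrow> R s * f s = 1" "\<And>s. s \<in> {0..1} \<Longrightarrow> f s * R s = 1"
    using inv unfolding f_def by metis
  define L where "L t = integral {0..t} (\<lambda>s. (c - 1) * R s)" for t
  have "continuous_on {0..1} f"
    unfolding f_def by (intro continuous_intros)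
  then have "continuous_on {0..1} R"
    by (rule continuous_on_inverse_path) (use R in auto)
  then have cont: "continuous_on {0..1} (\<lambda>s. (c - 1) * R s)"
    by (intro continuous_intros)
  have L_deriv: "(L has_vector_derivative (c - 1) * R t) (at t within {0..1})" if "t \<in> {0..1}" for t
    unfolding L_def by (rule integral_has_vector_derivative [OF cont that])
  have R_comm: "x * R s = R s * x" if x: "x * c = c * x" and s: "s \<in> {0..1}" for x s
  proof -
    have "x * f s = f s * x"
      using x by (simp add: f_def algebra_simps)
    then have "R s * (x * f s) * R s = R s * (f s * x) * R s" by simp
    then show ?thesis
      using R(1)[OF s] R(2)[OF s] by (metis mult.assoc mult_1_left mult_1_right)
  qed
  have int: "(\<lambda>s. (c - 1) * R s) integrable_on {0..t}" if "t \<in> {0..1}" for t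
    using cont that by (intro integrable_continuous_real) (auto intro: continuous_on_subset)
  have L_comm: "x * L t = L t * x" if x: "x * c = c * x" and t: "t \<in> {0..1}" for x t
  proof -
    have "x * L t = integral {0..t} (\<lambda>s. x * ((c - 1) * R s))"
      unfolding L_def
      using integral_linear[OF int[OF t] bounded_linear_mult_right[of x]] by (simp add: o_def)
    also have "\<dots> = integral {0..t} (\<lambda>s. ((c - 1) * R s) * x)"
    proof (rule integral_cong)
      fix s assume "s \<in> {0..t}"
      then have "x * R s = R s * x" using t x by (intro R_comm) auto
      moreover have "x * (c - 1) = (c - 1) * x" using x by (simp add: algebra_simps)
      ultimately show "x * ((c - 1) * R s) = ((c - 1) * R s) * x" by (metis mult.assoc)
    qed
    also have "\<dots> = L t * x"
      unfolding L_def
      using integral_linear[OF int[OF t] bounded_linear_mult_left[of x]] by (simp add: o_def)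
    finally show ?thesis .
  qed
  define g where "g t = exp (- L t) * f t" for t
  have g_deriv: "(g has_vector_derivative 0) (at t within {0..1})" if t: "t \<in> {0..1}" for t
  proof -
    have LL: "L s * L t = L t * L s" if "s \<in> {0..1}" for s
      using L_comm[OF L_comm[OF refl that, symmetric] t] by simp
    (* The rule for commuting paths asks for commutation at all times, whereas L is controlled
       on {0..1} only; L1 agrees with - L there and vanishes elsewhere. *)
    define L1 where "L1 s = (if s \<in> {0..1} then - L s else 0)" for s
    have "(L1 has_vector_derivative - ((c - 1) * R t)) (at t within {0..1})"
      using has_vector_derivative_minus[OF L_deriv[OF t]] t
      by (rule_tac has_vector_derivative_transform[of t _ L1 "\<lambda>s. - L s"]) (auto simp: L1_def)
    then have "((\<lambda>s. exp (L1 s)) has_vector_derivative exp (L1 t) * (- ((c - 1) * R t)))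
        (at t within {0..1})"
      by (rule exp_has_vector_derivative_commuting_path) (use t LL in \<open>auto simp: L1_def\<close>)
    then have "((\<lambda>s. exp (- L s)) has_vector_derivative exp (- L t) * (- ((c - 1) * R t)))
        (at t within {0..1})"
      using t by (rule_tac has_vector_derivative_transform[of t _ _ "\<lambda>s. exp (L1 s)"])
        (auto simp: L1_def)
    moreover have "(f has_vector_derivative (c - 1)) (at t within {0..1})"
      unfolding f_def by (auto intro!: derivative_eq_intros)
    ultimately have "(g has_vector_derivative
        exp (- L t) * (c - 1) + exp (- L t) * (- ((c - 1) * R t)) * f t) (at t within {0..1})"
      unfolding g_def by (rule has_vector_derivative_mult)
    moreover have "exp (- L t) * (- ((c - 1) * R t)) * f t = - (exp (- L t) * (c - 1))"
      using R(1)[OF t] by (simp add: mult.assoc)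
    ultimately show ?thesis by simp
  qed
  have "g 1 = g 0"
    by (rule has_derivative_zero_unique[of "{0..1}"])
       (use g_deriv in \<open>auto simp: has_vector_derivative_def\<close>)
  then have "exp (- L 1) * c = 1"
    by (simp add: g_def f_def L_def)
  then have "exp (L 1) = c"
    using exp_minus_inverse[of "L 1"] by (metis mult.assoc mult_1_left mult_1_right)
  then show thesis
    using that L_comm[of _ 1] by simp
qed

text \<open>
  Euler's formula for an operator with \<open>K\<^sup>2 = -1\<close> on one summand and \<open>K = 0\<close> on another.
\<close>

lemma exp_rotation:
  fixes K :: "'a::{real_normed_algebra_1,banach}"
  assumes K: "K * K * K = - K"
  shows "exp (t *\<^sub>R K) = 1 + sin t *\<^sub>R K + (1 - cos t) *\<^sub>R (K * K)"
proof -
  define f where "f t = 1 + sin t *\<^sub>R K + (1 - cos t) *\<^sub>R (K * K)" for t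
  define g where "g t = exp (t *\<^sub>R (- K)) * f t" for t
  have f_deriv: "(f has_vector_derivative cos t *\<^sub>R K + sin t *\<^sub>R (K * K)) (at t)" for t
    unfolding f_def by (auto intro!: derivative_eq_intros)
  have "(g has_vector_derivative 0) (at t)" for t
  proof -
    have "(g has_vector_derivative exp (t *\<^sub>R (- K)) * (cos t *\<^sub>R K + sin t *\<^sub>R (K * K))
        + exp (t *\<^sub>R (- K)) * (- K) * f t) (at t)"
      unfolding g_def
      by (intro has_vector_derivative_mult exp_scaleR_has_vector_derivative_right f_deriv)
    moreover have "K * f t = cos t *\<^sub>R K + sin t *\<^sub>R (K * K)"
      using K by (simp add: f_def algebra_simps)
    ultimately show ?thesis by (simp add: mult.assoc)
  qed
  then have "g t = g 0"
    by (intro has_derivative_zero_unique[of UNIV]) (auto simp: has_vector_derivative_def)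
  then have "exp (- (t *\<^sub>R K)) * f t = 1"
    by (simp add: g_def f_def)
  then have "exp (t *\<^sub>R K) * (exp (- (t *\<^sub>R K)) * f t) = exp (t *\<^sub>R K)" by simp
  then have "f t = exp (t *\<^sub>R K)"
    by (simp add: mult.assoc [symmetric] exp_minus_inverse)
  then show ?thesis by (simp add: f_def)
qed

section \<open>The Banach algebra of operators on a Euclidean space\<close>

text \<open>
  A copy of the bounded linear maps of a space into itself. Composition makes it a ring with unit,
  so that the exponential of Banach algebras applies; the operator norm gives \<open>norm 1 = 1\<close>, which
  fails for the Euclidean norm of matrices with more than one row.
\<close>

typedef (overloaded) 'a endo = "UNIV :: ('a::euclidean_space \<Rightarrow>\<^sub>L 'a) set"
  morphisms blinfun_of_endo endo_of_blinfun ..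

setup_lifting type_definition_endo

instantiation endo :: (euclidean_space) real_vector
begin

lift_definition zero_endo :: "'a endo" is 0 .
lift_definition plus_endo :: "'a endo \<Rightarrow> 'a endo \<Rightarrow> 'a endo" is "(+)" .
lift_definition minus_endo :: "'a endo \<Rightarrow> 'a endo \<Rightarrow> 'a endo" is "(-)" .
lift_definition uminus_endo :: "'a endo \<Rightarrow> 'a endo" is uminus .
lift_definition scaleR_endo :: "real \<Rightarrow> 'a endo \<Rightarrow> 'a endo" is "(*\<^sub>R)" .

instance
  by standard (transfer, simp add: algebra_simps)+

end

instantiation endo :: (euclidean_space) real_normed_algebra_1
begin

lift_definition one_endo :: "'a endo" is id_blinfun .
lift_definition times_endo :: "'a endo \<Rightarrow> 'a endo \<Rightarrow> 'a endo" is "(o\<^sub>L)" .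
lift_definition norm_endo :: "'a endo \<Rightarrow> real" is norm .
lift_definition dist_endo :: "'a endo \<Rightarrow> 'a endo \<Rightarrow> real" is dist .

definition "sgn x = x /\<^sub>R norm x" for x :: "'a endo"
definition [code del]:
  "(uniformity :: ('a endo \<times> 'a endo) filter) =
    (INF e\<in>{0 <..}. principal {(x, y). dist x y < e})"
definition [code del]:
  "open (U :: 'a endo set) \<longleftrightarrow>
    (\<forall>x\<in>U. eventually (\<lambda>(x', y). x' = x \<longrightarrow> y \<in> U) uniformity)"

instance
proof
  fix a b c :: "'a endo" and r s :: real
  show "dist a b = norm (a - b)" by transfer (rule dist_norm)
  show "norm a = 0 \<longleftrightarrow> a = 0" "norm (a + b) \<le> norm a + norm b"
    "norm (r *\<^sub>R a) = \<bar>r\<bar> * norm a"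
    by (transfer, simp add: norm_triangle_ineq)+
  show "norm (a * b) \<le> norm a * norm b"
    by transfer (rule norm_blinfun_compose)
  show "norm (1 :: 'a endo) = 1" by transfer simp
  show "(0 :: 'a endo) \<noteq> 1"
    by transfer (metis norm_blinfun_id norm_zero zero_neq_one)
  show "a * b * c = a * (b * c)" "(a + b) * c = a * c + b * c" "a * (b + c) = a * b + a * c"
    "1 * a = a" "a * 1 = a" "r *\<^sub>R a * b = r *\<^sub>R (a * b)" "a * r *\<^sub>R b = r *\<^sub>R (a * b)"
    by (transfer, rule blinfun_eqI, simp add: blinfun.bilinear_simps)+
qed (rule sgn_endo_def uniformity_endo_def open_endo_def)+

end

instance endo :: (euclidean_space) banach
proof
  fix X :: "nat \<Rightarrow> 'a endo"
  assume "Cauchy X"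
  then have "Cauchy (\<lambda>n. blinfun_of_endo (X n))"
    by (simp add: Cauchy_def dist_endo.rep_eq)
  then obtain l where "(\<lambda>n. blinfun_of_endo (X n)) \<longlonglongrightarrow> l"
    by (auto simp: Cauchy_convergent_iff convergent_def)
  then have "X \<longlonglongrightarrow> endo_of_blinfun l"
    by (simp add: tendsto_iff dist_endo.rep_eq endo_of_blinfun_inverse)
  then show "convergent X" by (auto simp: convergent_def)
qed

lift_definition app :: "'a::euclidean_space endo \<Rightarrow> 'a \<Rightarrow> 'a" (infixr "\<bullet>\<^sub>e" 75) is blinfun_apply .

lift_definition endo :: "('a::euclidean_space \<Rightarrow> 'a) \<Rightarrow> 'a endo" is Blinfun .

lemma app_endo: "linear f \<Longrightarrow> endo f \<bullet>\<^sub>e v = f v"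
  by transfer (simp add: bounded_linear_Blinfun_apply linear_conv_bounded_linear)

lemma endo_eqI: "(\<And>v. a \<bullet>\<^sub>e v = b \<bullet>\<^sub>e v) \<Longrightarrow> a = b"
  by transfer (rule blinfun_eqI)

lemma linear_app: "linear ((\<bullet>\<^sub>e) a)"
  by transfer (rule bounded_linear.linear [OF blinfun.bounded_linear_right])

lemma app_simps [simp]:
  "(a * b) \<bullet>\<^sub>e v = a \<bullet>\<^sub>e b \<bullet>\<^sub>e v" "(a + b) \<bullet>\<^sub>e v = a \<bullet>\<^sub>e v + b \<bullet>\<^sub>e v" "(a - b) \<bullet>\<^sub>e v = a \<bullet>\<^sub>e v - b \<bullet>\<^sub>e v"
  "(- a) \<bullet>\<^sub>e v = - (a \<bullet>\<^sub>e v)" "(r *\<^sub>R a) \<bullet>\<^sub>e v = r *\<^sub>R (a \<bullet>\<^sub>e v)" "1 \<bullet>\<^sub>e v = v" "0 \<bullet>\<^sub>e v = 0"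
  "a \<bullet>\<^sub>e (v + w) = a \<bullet>\<^sub>e v + a \<bullet>\<^sub>e w" "a \<bullet>\<^sub>e (v - w) = a \<bullet>\<^sub>e v - a \<bullet>\<^sub>e w"
  "a \<bullet>\<^sub>e (r *\<^sub>R v) = r *\<^sub>R (a \<bullet>\<^sub>e v)" "a \<bullet>\<^sub>e 0 = 0" "a \<bullet>\<^sub>e (- v) = - (a \<bullet>\<^sub>e v)"
  by (transfer, simp add: blinfun.bilinear_simps)+

lemma norm_app: "norm (a \<bullet>\<^sub>e v) \<le> norm a * norm v"
  by transfer (rule norm_blinfun)

lemma endo_invertible_if_injective:
  assumes "\<And>v. a \<bullet>\<^sub>e v = 0 \<Longrightarrow> v = 0"
  obtains r where "r * a = 1" "a * r = 1"
proof -
  have "inj ((\<bullet>\<^sub>e) a)"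
    using assms linear_injective_0 [OF linear_app] by blast
  then obtain g where g: "linear g" "\<And>x. g (a \<bullet>\<^sub>e x) = x" "\<And>x. a \<bullet>\<^sub>e g x = x"
    using linear_injective_isomorphism [OF linear_app] by blast
  have "endo g * a = 1" "a * endo g = 1"
    by (rule endo_eqI, simp add: app_endo g)+
  then show thesis by (rule that)
qed

section \<open>Complex halves of quaternionic spaces\<close>

text \<open>
  \<open>I\<close> and \<open>J\<close> play the part of right multiplication by \<open>i\<close> and \<open>j\<close> on a quaternionic vector
  space, and \<open>c\<close> that of a quaternion-linear operator. Right multiplication by \<open>k = i j\<close> is then
  \<open>J I\<close>, because right multiplications compose in the opposite order.
\<close>

locale quaternionic_operator =
  fixes I J c :: "'a::euclidean_space endo"
  assumes squares: "I * I = - 1" "J * J = - 1"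
    and anticommute: "J * I = - (I * J)"
    and commute: "c * I = I * c" "c * J = J * c"
begin

lemma app_relations:
  "I \<bullet>\<^sub>e I \<bullet>\<^sub>e v = - v" "J \<bullet>\<^sub>e J \<bullet>\<^sub>e v = - v" "J \<bullet>\<^sub>e I \<bullet>\<^sub>e v = - (I \<bullet>\<^sub>e J \<bullet>\<^sub>e v)"
  "c \<bullet>\<^sub>e I \<bullet>\<^sub>e v = I \<bullet>\<^sub>e c \<bullet>\<^sub>e v" "c \<bullet>\<^sub>e J \<bullet>\<^sub>e v = J \<bullet>\<^sub>e c \<bullet>\<^sub>e v"
  using squares anticommute commute by (metis app_simps)+

text \<open>
  A complex subspace \<open>U\<close> is a half if \<open>U\<close> and \<open>J U\<close> meet only in \<open>0\<close>. Then \<open>double U\<close> is the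
  quaternionic subspace that \<open>U\<close> generates, and \<open>U\<close> has half the dimension of \<open>double U\<close>.
\<close>

definition half :: "'a set \<Rightarrow> bool" where
  "half U \<longleftrightarrow> subspace U \<and> (\<forall>u\<in>U. I \<bullet>\<^sub>e u \<in> U) \<and> (\<forall>u\<in>U. J \<bullet>\<^sub>e u \<in> U \<longrightarrow> u = 0)"

definition double :: "'a set \<Rightarrow> 'a set" where
  "double U = {u + J \<bullet>\<^sub>e w |u w. u \<in> U \<and> w \<in> U}"

lemma half_unique:
  assumes "half U" "u \<in> U" "w \<in> U" "u' \<in> U" "w' \<in> U" "u + J \<bullet>\<^sub>e w = u' + J \<bullet>\<^sub>e w'"
  shows "u = u'" "w = w'"
proof -
  have "J \<bullet>\<^sub>e (w - w') = u' - u"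
    using assms(6) by (simp add: algebra_simps)
  then have "w - w' = 0"
    using assms by (metis half_def subspace_diff)
  then show "w = w'" by simp
  with assms(6) show "u = u'" by simp
qed

lemma double_props:
  assumes "half U"
  shows "subspace (double U)" "U \<subseteq> double U"
    "v \<in> double U \<Longrightarrow> I \<bullet>\<^sub>e v \<in> double U" "v \<in> double U \<Longrightarrow> J \<bullet>\<^sub>e v \<in> double U"
proof -
  have U: "subspace U" "\<And>u. u \<in> U \<Longrightarrow> I \<bullet>\<^sub>e u \<in> U"
    using assms by (auto simp: half_def)
  show "subspace (double U)"
  proof (rule subspaceI)
    show "0 \<in> double U"
      unfolding double_def using subspace_0[OF U(1)] by force
    show "x + y \<in> double U" if xy: "x \<in> double U" "y \<in> double U" for x y
    proof -
      obtain a b a' b' where "x = a + J \<bullet>\<^sub>e b" "y = a' + J \<bullet>\<^sub>e b'" "a \<in> U" "b \<in> U" "a' \<in> U" "b' \<in> U"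
        using xy by (auto simp: double_def)
      then have "x + y = (a + a') + J \<bullet>\<^sub>e (b + b')" "a + a' \<in> U" "b + b' \<in> U"
        using U(1) by (auto simp: subspace_add)
      then show ?thesis unfolding double_def by blast
    qed
    show "r *\<^sub>R x \<in> double U" if x: "x \<in> double U" for r x
    proof -
      obtain a b where "x = a + J \<bullet>\<^sub>e b" "a \<in> U" "b \<in> U"
        using x by (auto simp: double_def)
      then have "r *\<^sub>R x = r *\<^sub>R a + J \<bullet>\<^sub>e (r *\<^sub>R b)" "r *\<^sub>R a \<in> U" "r *\<^sub>R b \<in> U"
        using U(1) by (auto simp: subspace_scale scaleR_add_right)
      then show ?thesis unfolding double_def by blast
    qed
  qed
  show "U \<subseteq> double U"
    unfolding double_def using subspace_0[OF U(1)] by force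
  assume "v \<in> double U"
  then obtain u w where v: "v = u + J \<bullet>\<^sub>e w" "u \<in> U" "w \<in> U"
    by (auto simp: double_def)
  have "I \<bullet>\<^sub>e v = I \<bullet>\<^sub>e u + J \<bullet>\<^sub>e (- (I \<bullet>\<^sub>e w))" "J \<bullet>\<^sub>e v = - w + J \<bullet>\<^sub>e u"
    using v(1) by (auto simp: app_relations)
  moreover have "I \<bullet>\<^sub>e u \<in> U" "- (I \<bullet>\<^sub>e w) \<in> U" "- w \<in> U"
    using U v by (auto simp: subspace_neg)
  ultimately show "I \<bullet>\<^sub>e v \<in> double U" "J \<bullet>\<^sub>e v \<in> double U"
    unfolding double_def using v(2) by blast+
qed

text \<open>
  Take \<open>U\<close> of maximal dimension. For a vector \<open>x\<close> of \<open>X\<close> outside \<open>double U\<close>, the complex span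
  of \<open>U\<close> and \<open>x\<close> would be a larger half: a common element of it and of its image under \<open>J\<close> yields
  a quaternion \<open>h\<close> with \<open>x h \<in> double U\<close>, and a nonzero \<open>h\<close> could be inverted.
\<close>

lemma half_extend_to_double:
  assumes U0: "half U0" "U0 \<subseteq> X" and X: "subspace X" "\<And>x. x \<in> X \<Longrightarrow> I \<bullet>\<^sub>e x \<in> X"
  obtains U where "half U" "U0 \<subseteq> U" "U \<subseteq> X" "X \<subseteq> double U"
proof -
  define P where "P U \<longleftrightarrow> half U \<and> U0 \<subseteq> U \<and> U \<subseteq> X" for U
  have "P U0" using U0 by (simp add: P_def)
  then obtain U where U: "P U" and max: "\<And>U'. P U' \<Longrightarrow> dim U' \<le> dim U"
    using ex_has_greatest_nat[of P U0 dim "Suc DIM('a)"]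
    by (auto simp: less_Suc_eq_le dim_subset_UNIV)
  have hU: "half U" "subspace U" "\<And>u. u \<in> U \<Longrightarrow> I \<bullet>\<^sub>e u \<in> U"
    and JU: "\<And>u. u \<in> U \<Longrightarrow> J \<bullet>\<^sub>e u \<in> U \<Longrightarrow> u = 0" and UX: "U0 \<subseteq> U" "U \<subseteq> X"
    using U by (auto simp: P_def half_def)
  note W = double_props[OF hU(1)]
  have "X \<subseteq> double U"
  proof (rule ccontr)
    assume "\<not> X \<subseteq> double U"
    then obtain x where x: "x \<in> X" "x \<notin> double U" by blast
    define U' where "U' = {u + a *\<^sub>R x + b *\<^sub>R (I \<bullet>\<^sub>e x) |u a b. u \<in> U}"
    have U'I: "u + a *\<^sub>R x + b *\<^sub>R (I \<bullet>\<^sub>e x) \<in> U'" if "u \<in> U" for u a b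
      using that by (auto simp: U'_def)
    have sub: "subspace U'"
    proof (rule subspaceI)
      show "0 \<in> U'"
        using U'I[OF subspace_0[OF hU(2)], of 0 0] by simp
      show "y + z \<in> U'" if yz: "y \<in> U'" "z \<in> U'" for y z
      proof -
        obtain u a b u' a' b' where "y = u + a *\<^sub>R x + b *\<^sub>R (I \<bullet>\<^sub>e x)" "u \<in> U"
          "z = u' + a' *\<^sub>R x + b' *\<^sub>R (I \<bullet>\<^sub>e x)" "u' \<in> U"
          using yz unfolding U'_def by blast
        then show ?thesis
          using U'I[of "u + u'" "a + a'" "b + b'"] subspace_add[OF hU(2)]
          by (simp add: algebra_simps)
      qed
      show "r *\<^sub>R y \<in> U'" if y: "y \<in> U'" for r y
      proof -
        obtain u a b where "y = u + a *\<^sub>R x + b *\<^sub>R (I \<bullet>\<^sub>e x)" "u \<in> U"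
          using y unfolding U'_def by blast
        then show ?thesis
          using U'I[of "r *\<^sub>R u" "r * a" "r * b"] subspace_scale[OF hU(2)]
          by (simp add: algebra_simps)
      qed
    qed
    have "half U'"
      unfolding half_def
    proof (intro conjI ballI impI sub)
      fix y assume "y \<in> U'"
      then obtain u a b where y: "y = u + a *\<^sub>R x + b *\<^sub>R (I \<bullet>\<^sub>e x)" "u \<in> U"
        unfolding U'_def by blast
      show "I \<bullet>\<^sub>e y \<in> U'"
        using U'I[of "I \<bullet>\<^sub>e u" "- b" a] hU(3)[OF y(2)] y(1)
        by (simp add: app_relations algebra_simps)
      assume "J \<bullet>\<^sub>e y \<in> U'"
      then obtain u' a' b' where y': "J \<bullet>\<^sub>e y = u' + a' *\<^sub>R x + b' *\<^sub>R (I \<bullet>\<^sub>e x)" "u' \<in> U"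
        unfolding U'_def by blast
      define z where "z = a *\<^sub>R J \<bullet>\<^sub>e x - b *\<^sub>R I \<bullet>\<^sub>e J \<bullet>\<^sub>e x - a' *\<^sub>R x - b' *\<^sub>R I \<bullet>\<^sub>e x"
      have "z = u' - J \<bullet>\<^sub>e u"
        using y(1) y'(1) by (simp add: z_def app_relations algebra_simps)
      then have zW: "z \<in> double U"
        using W y(2) y'(2) by (metis subsetD subspace_diff)
      (* z is x multiplied by a quaternion h. Multiplying z by the conjugate of h turns it into
         the real multiple s x, where s is the squared norm of h. *)
      define s where "s = a\<^sup>2 + b\<^sup>2 + a'\<^sup>2 + b'\<^sup>2"
      have "- (a *\<^sub>R J \<bullet>\<^sub>e z) + b *\<^sub>R I \<bullet>\<^sub>e J \<bullet>\<^sub>e z - a' *\<^sub>R z + b' *\<^sub>R I \<bullet>\<^sub>e z \<in> double U"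
        using W zW by (intro subspace_add subspace_diff subspace_scale subspace_neg) auto
      moreover have "- (a *\<^sub>R J \<bullet>\<^sub>e z) + b *\<^sub>R I \<bullet>\<^sub>e J \<bullet>\<^sub>e z - a' *\<^sub>R z + b' *\<^sub>R I \<bullet>\<^sub>e z = s *\<^sub>R x"
        unfolding z_def s_def
        by (simp add: app_relations algebra_simps power2_eq_square)
      ultimately have "s *\<^sub>R x \<in> double U" by simp
      then have "s = 0"
        using x(2) subspace_scale[OF W(1), of "s *\<^sub>R x" "1 / s"] by (cases "s = 0") auto
      then have "a = 0" "b = 0" "a' = 0" "b' = 0"
        unfolding s_def by (auto simp: add_nonneg_eq_0_iff)
      then show "y = 0"
        using y y' JU[of u] by simp
    qed
    moreover have "U \<subseteq> U'"
    proof
      show "u \<in> U'" if "u \<in> U" for u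
        using U'I[OF that, of 0 0] by simp
    qed
    moreover have "U' \<subseteq> X"
      using UX X x(1) by (auto simp: U'_def intro!: subspace_add subspace_scale)
    ultimately have "P U'" using UX by (auto simp: P_def)
    moreover have "x \<in> U'" using U'I[OF subspace_0[OF hU(2)], of 1 0] by simp
    then have "U \<subset> U'" using \<open>U \<subseteq> U'\<close> x(2) W(2) by blast
    then have "dim U < dim U'"
      using dim_psubset[of U U'] hU(2) sub by (simp add: span_eq_iff[THEN iffD2])
    ultimately show False using max[of U'] by simp
  qed
  then show thesis using that hU(1) UX by blast
qed

end

text \<open>
  The value at \<open>c\<close> of the polynomial with the given list of real roots.
\<close>

primrec root_product :: "'a::real_algebra_1 \<Rightarrow> real list \<Rightarrow> 'a" where
  "root_product c [] = 1"
| "root_product c (l # ls) = root_product c ls * (c - l *\<^sub>R 1)"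

lemma root_product_append: "root_product c (ls @ ms) = root_product c ms * root_product c ls"
  by (induction ls) (simp_all add: mult.assoc)

lemma root_product_commutes:
  assumes "x * c = c * x"
  shows "x * root_product c ls = root_product c ls * x"
proof (induction ls)
  case (Cons l ls)
  have "x * (c - l *\<^sub>R 1) = (c - l *\<^sub>R 1) * x"
    using assms by (simp add: algebra_simps)
  then have "root_product c ls * (x * (c - l *\<^sub>R 1)) = root_product c ls * (c - l *\<^sub>R 1) * x"
    by (simp add: mult.assoc)
  then show ?case using Cons.IH by (simp add: mult.assoc [symmetric])
qed simp

context quaternionic_operator
begin

text \<open>
  Every split quaternionic operator comes from a complex operator, defined on a half. With
  \<open>N = c - \<lambda>\<close>, a \<open>c\<close>-invariant half \<open>U0\<close> of \<open>N V\<close> is enlarged inside its preimage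
  \<open>X = {v \<in> V. N v \<in> U0}\<close>. Any complex \<open>U\<close> with \<open>U0 \<subseteq> U \<subseteq> X\<close> satisfies \<open>N U \<subseteq> U0 \<subseteq> U\<close>, so
  invariance costs nothing. Since \<open>N V\<close> is the double of \<open>U0\<close> and \<open>X\<close> contains the kernel of
  \<open>N\<close>, every vector of \<open>V\<close> lies in \<open>X + J X\<close>.
\<close>

lemma half_of_split_submodule:
  assumes "subspace V" "\<And>v. v \<in> V \<Longrightarrow> I \<bullet>\<^sub>e v \<in> V" "\<And>v. v \<in> V \<Longrightarrow> J \<bullet>\<^sub>e v \<in> V"
    "\<And>v. v \<in> V \<Longrightarrow> c \<bullet>\<^sub>e v \<in> V" "\<And>v. v \<in> V \<Longrightarrow> root_product c ls \<bullet>\<^sub>e v = 0"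
  shows "\<exists>U. half U \<and> (\<forall>u\<in>U. c \<bullet>\<^sub>e u \<in> U) \<and> double U = V"
  using assms
proof (induction ls arbitrary: V)
  case Nil
  then have "V = {0}" using subspace_0[of V] by auto
  then show ?case
    by (intro exI[of _ "{0}"]) (auto simp: half_def double_def)
next
  case (Cons l ls)
  define N where "N = c - l *\<^sub>R 1"
  have N_comm: "N \<bullet>\<^sub>e I \<bullet>\<^sub>e v = I \<bullet>\<^sub>e N \<bullet>\<^sub>e v" "N \<bullet>\<^sub>e J \<bullet>\<^sub>e v = J \<bullet>\<^sub>e N \<bullet>\<^sub>e v"
    "N \<bullet>\<^sub>e c \<bullet>\<^sub>e v = c \<bullet>\<^sub>e N \<bullet>\<^sub>e v" "N \<bullet>\<^sub>e v = c \<bullet>\<^sub>e v - l *\<^sub>R v" for v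
    by (simp_all add: N_def app_relations)
  have N_V: "N \<bullet>\<^sub>e v \<in> V" if "v \<in> V" for v
    using that Cons.prems by (simp add: N_comm(4) subspace_diff subspace_scale)
  define V' where "V' = (\<bullet>\<^sub>e) N ` V"
  have "\<exists>U. half U \<and> (\<forall>u\<in>U. c \<bullet>\<^sub>e u \<in> U) \<and> double U = V'"
  proof (rule Cons.IH)
    show "subspace V'"
      unfolding V'_def by (intro linear_subspace_image linear_app Cons.prems)
    show "I \<bullet>\<^sub>e v \<in> V'" "J \<bullet>\<^sub>e v \<in> V'" "c \<bullet>\<^sub>e v \<in> V'" "root_product c ls \<bullet>\<^sub>e v = 0" if "v \<in> V'" for v
      using that Cons.prems(2-5) N_comm(1-3) unfolding V'_def
      by (auto simp: N_def[symmetric] image_iff) metis+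
  qed
  then obtain U0 where U0: "half U0" "\<And>u. u \<in> U0 \<Longrightarrow> c \<bullet>\<^sub>e u \<in> U0" "double U0 = V'" by blast
  note U0s = double_props(2)[OF U0(1)]
  have sU0: "subspace U0" "\<And>u. u \<in> U0 \<Longrightarrow> I \<bullet>\<^sub>e u \<in> U0" using U0(1) by (auto simp: half_def)
  have V'V: "V' \<subseteq> V" using N_V by (auto simp: V'_def)
  define X where "X = {v \<in> V. N \<bullet>\<^sub>e v \<in> U0}"
  have X: "subspace X"
    unfolding X_def subspace_def
    using Cons.prems(1) sU0(1) by (auto simp: subspace_0 subspace_add subspace_scale)
  have XI: "I \<bullet>\<^sub>e x \<in> X" if "x \<in> X" for x
    using that Cons.prems(2) sU0(2) by (auto simp: X_def N_comm(1))
  have U0X: "U0 \<subseteq> X"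
    using U0s U0 V'V sU0 by (auto simp: X_def N_comm(4) subspace_diff subspace_scale)
  obtain U where U: "half U" "U0 \<subseteq> U" "U \<subseteq> X" "X \<subseteq> double U"
    using half_extend_to_double[OF U0(1) U0X X XI] by blast
  note W = double_props[OF U(1)]
  have sU: "subspace U" using U(1) by (simp add: half_def)
  have "c \<bullet>\<^sub>e u \<in> U" if "u \<in> U" for u
  proof -
    have "N \<bullet>\<^sub>e u \<in> U" using that U by (auto simp: X_def)
    then have "N \<bullet>\<^sub>e u + l *\<^sub>R u \<in> U" using that sU by (simp add: subspace_add subspace_scale)
    then show ?thesis by (simp add: N_comm(4))
  qed
  moreover have "double U = V"
  proof
    show "double U \<subseteq> V"
      using U(3) Cons.prems(1,3) by (auto simp: double_def X_def intro!: subspace_add)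
    show "V \<subseteq> double U"
    proof
      fix v assume v: "v \<in> V"
      then have "N \<bullet>\<^sub>e v \<in> double U0" by (simp add: U0(3) V'_def)
      then obtain u w where uw: "N \<bullet>\<^sub>e v = u + J \<bullet>\<^sub>e w" "u \<in> U0" "w \<in> U0" by (auto simp: double_def)
      have "u \<in> V'" "w \<in> V'" using uw U0s U0(3) by auto
      then obtain a b where ab: "a \<in> V" "b \<in> V" "u = N \<bullet>\<^sub>e a" "w = N \<bullet>\<^sub>e b"
        by (auto simp: V'_def)
      define k where "k = v - a - J \<bullet>\<^sub>e b"
      have "a \<in> X" "b \<in> X" using ab uw by (auto simp: X_def)
      moreover have "N \<bullet>\<^sub>e k = 0" using ab uw by (simp add: k_def N_comm(2))
      then have "k \<in> X"
        using Cons.prems(1,3) ab v subspace_0[OF sU0(1)]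
        by (auto simp: X_def k_def intro!: subspace_diff)
      ultimately have "k \<in> double U" "a \<in> double U" "J \<bullet>\<^sub>e b \<in> double U" using U(4) W(4) by auto
      then have "k + a + J \<bullet>\<^sub>e b \<in> double U" using W(1) by (intro subspace_add)
      then show "v \<in> double U" by (simp add: k_def)
    qed
  qed
  ultimately show ?case using U(1) by blast
qed

end

text \<open>
  Among all products \<open>q\<close> of factors \<open>c - \<lambda>\<close> with \<open>\<lambda> < 0\<close>, choose one with a kernel of largest
  dimension. Further factors do not enlarge this kernel. Hence \<open>ker q\<^sup>2 = ker q\<close>, which makes the
  space the direct sum of the kernel and the range of \<open>q\<close>, and the range contains no eigenvector
  for a negative eigenvalue.
\<close>

lemma negative_spectrum_split:
  fixes c :: "'a::euclidean_space endo"
  obtains ls where "set ls \<subseteq> {..<0}"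
    "\<And>v. root_product c ls \<bullet>\<^sub>e root_product c ls \<bullet>\<^sub>e v = 0 \<Longrightarrow> root_product c ls \<bullet>\<^sub>e v = 0"
    "\<And>l v. l < 0 \<Longrightarrow> c \<bullet>\<^sub>e root_product c ls \<bullet>\<^sub>e v = l *\<^sub>R root_product c ls \<bullet>\<^sub>e v \<Longrightarrow>
      root_product c ls \<bullet>\<^sub>e v = 0"
    "\<And>v. \<exists>w. root_product c ls \<bullet>\<^sub>e (v - root_product c ls \<bullet>\<^sub>e w) = 0"
proof -
  define k where "k ls = {v. root_product c ls \<bullet>\<^sub>e v = 0}" for ls
  have sub: "subspace (k ls)" for ls
    unfolding k_def by (auto simp: subspace_def)
  obtain ls where ls: "set ls \<subseteq> {..<0}" and max: "\<And>ms. set ms \<subseteq> {..<0} \<Longrightarrow> dim (k ms) \<le> dim (k ls)"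
    using ex_has_greatest_nat[of "\<lambda>ls. set ls \<subseteq> {..<0}" "[]" "\<lambda>ls. dim (k ls)" "Suc DIM('a)"]
    by (auto simp: less_Suc_eq_le dim_subset_UNIV)
  define q where "q = root_product c ls"
  have stable: "q \<bullet>\<^sub>e v = 0" if "set ms \<subseteq> {..<0}" "root_product c ms \<bullet>\<^sub>e q \<bullet>\<^sub>e v = 0" for ms v
  proof -
    have "k ls \<subseteq> k (ls @ ms)" by (auto simp: k_def root_product_append)
    moreover have "dim (k (ls @ ms)) \<le> dim (k ls)" using that ls by (intro max) auto
    ultimately have "k ls = k (ls @ ms)"
      by (intro subspace_dim_equal sub) auto
    moreover have "v \<in> k (ls @ ms)" using that(2) by (simp add: k_def root_product_append q_def)
    ultimately show ?thesis by (auto simp: k_def q_def)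
  qed
  have square: "q \<bullet>\<^sub>e v = 0" if "q \<bullet>\<^sub>e q \<bullet>\<^sub>e v = 0" for v
    using stable[of ls v] that ls by (simp add: q_def)
  have "q \<bullet>\<^sub>e v = 0" if "l < 0" "c \<bullet>\<^sub>e q \<bullet>\<^sub>e v = l *\<^sub>R q \<bullet>\<^sub>e v" for l v
    using stable[of "[l]" v] that by simp
  moreover have "\<exists>w. q \<bullet>\<^sub>e (v - q \<bullet>\<^sub>e w) = 0" for v
  proof -
    let ?P = "range ((\<bullet>\<^sub>e) q)"
    have sP: "subspace ?P" by (intro linear_subspace_image linear_app) simp
    have "inj_on ((\<bullet>\<^sub>e) q) ?P"
    proof (rule inj_onI)
      fix x y assume "x \<in> ?P" "y \<in> ?P" and eq: "q \<bullet>\<^sub>e x = q \<bullet>\<^sub>e y"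
      then obtain x' y' where xy: "x = q \<bullet>\<^sub>e x'" "y = q \<bullet>\<^sub>e y'" by auto
      then show "x = y" using square[of "x' - y'"] eq by simp
    qed
    then have "dim ((\<bullet>\<^sub>e) q ` ?P) = dim ?P"
      using sP by (intro dim_image_eq linear_app) (simp add: span_eq_iff[THEN iffD2])
    moreover have "subspace ((\<bullet>\<^sub>e) q ` ?P)" by (intro linear_subspace_image linear_app sP)
    ultimately have "(\<bullet>\<^sub>e) q ` ?P = ?P" by (intro subspace_dim_equal sP) auto
    then have "q \<bullet>\<^sub>e v \<in> (\<bullet>\<^sub>e) q ` ?P" by blast
    then show ?thesis by auto
  qed
  ultimately show thesis using that[OF ls] square unfolding q_def by blast
qed

section \<open>Logarithms of quaternionic operators\<close>

context quaternionic_operator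
begin

text \<open>
  Write each vector as \<open>u + J w + p\<close> with \<open>u, w\<close> in a \<open>c\<close>-invariant half \<open>U\<close> of the negative
  generalized eigenspace and \<open>p\<close> in the complement. \<open>K\<close> is \<open>I\<close> on \<open>U\<close>, extended
  quaternion-linearly to \<open>double U\<close>, and \<open>0\<close> on the complement. The factor \<open>1 + 2 K\<^sup>2\<close>
  changes the sign of \<open>u + J w\<close> only, and thereby makes the negative eigenvalues positive.
\<close>

lemma rotation_removing_negative_spectrum:
  assumes inj: "\<And>v. c \<bullet>\<^sub>e v = 0 \<Longrightarrow> v = 0"
  obtains K where "K * K * K = - K" "K * I = I * K" "K * J = J * K" "K * c = c * K"
    "\<And>l v. l \<le> 0 \<Longrightarrow> c \<bullet>\<^sub>e (1 + 2 *\<^sub>R (K * K)) \<bullet>\<^sub>e v = l *\<^sub>R v \<Longrightarrow> v = 0"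
proof -
  obtain ls where neg: "set ls \<subseteq> {..<0}"
    and sq: "\<And>v. root_product c ls \<bullet>\<^sub>e root_product c ls \<bullet>\<^sub>e v = 0 \<Longrightarrow> root_product c ls \<bullet>\<^sub>e v = 0"
    and noneg: "\<And>l v. l < 0 \<Longrightarrow> c \<bullet>\<^sub>e root_product c ls \<bullet>\<^sub>e v = l *\<^sub>R root_product c ls \<bullet>\<^sub>e v \<Longrightarrow>
      root_product c ls \<bullet>\<^sub>e v = 0"
    and dec: "\<And>v. \<exists>w. root_product c ls \<bullet>\<^sub>e (v - root_product c ls \<bullet>\<^sub>e w) = 0"
    by (rule negative_spectrum_split[of c]) blast
  define q where "q = root_product c ls"
  have q_comm: "q \<bullet>\<^sub>e I \<bullet>\<^sub>e v = I \<bullet>\<^sub>e q \<bullet>\<^sub>e v" "q \<bullet>\<^sub>e J \<bullet>\<^sub>e v = J \<bullet>\<^sub>e q \<bullet>\<^sub>e v" "q \<bullet>\<^sub>e c \<bullet>\<^sub>e v = c \<bullet>\<^sub>e q \<bullet>\<^sub>e v" for v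
    using root_product_commutes[of _ c ls] commute unfolding q_def
    by (metis app_simps(1))+
  define V where "V = {v. q \<bullet>\<^sub>e v = 0}"
  have "subspace V"
    by (auto simp: V_def subspace_def)
  then have "\<exists>U. half U \<and> (\<forall>u\<in>U. c \<bullet>\<^sub>e u \<in> U) \<and> double U = V"
    by (rule half_of_split_submodule[where ls = ls]) (auto simp: V_def q_comm simp flip: q_def)
  then obtain U where U: "half U" "\<And>u. u \<in> U \<Longrightarrow> c \<bullet>\<^sub>e u \<in> U" "double U = V" by blast
  have sU: "subspace U" "\<And>u. u \<in> U \<Longrightarrow> I \<bullet>\<^sub>e u \<in> U"
    using U(1) by (auto simp: half_def)
  define D where "D v u w z \<longleftrightarrow> u \<in> U \<and> w \<in> U \<and> v = u + J \<bullet>\<^sub>e w + q \<bullet>\<^sub>e z" for v u w z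
  have D_ex: "\<exists>u w z. D v u w z" for v
  proof -
    obtain z where "v - q \<bullet>\<^sub>e z \<in> V" using dec[of v] by (auto simp: V_def q_def)
    then obtain u w where "v - q \<bullet>\<^sub>e z = u + J \<bullet>\<^sub>e w" "u \<in> U" "w \<in> U"
      unfolding U(3)[symmetric] double_def by blast
    then show ?thesis unfolding D_def by (metis diff_add_cancel)
  qed
  have V_I: "u + J \<bullet>\<^sub>e w \<in> V" if "u \<in> U" "w \<in> U" for u w
    using that unfolding U(3)[symmetric] double_def by blast
  have D_unique: "u = u' \<and> w = w' \<and> q \<bullet>\<^sub>e z = q \<bullet>\<^sub>e z'" if "D v u w z" "D v u' w' z'" for v u w z u' w' z'
  proof -
    have uw: "u \<in> U" "w \<in> U" "u' \<in> U" "w' \<in> U"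
      and eq: "u + J \<bullet>\<^sub>e w + q \<bullet>\<^sub>e z = u' + J \<bullet>\<^sub>e w' + q \<bullet>\<^sub>e z'"
      using that by (auto simp: D_def)
    have "q \<bullet>\<^sub>e (u + J \<bullet>\<^sub>e w) = 0" "q \<bullet>\<^sub>e (u' + J \<bullet>\<^sub>e w') = 0"
      using V_I uw by (auto simp: V_def)
    moreover have "q \<bullet>\<^sub>e (u + J \<bullet>\<^sub>e w + q \<bullet>\<^sub>e z) = q \<bullet>\<^sub>e (u' + J \<bullet>\<^sub>e w' + q \<bullet>\<^sub>e z')"
      by (simp only: eq)
    ultimately have "q \<bullet>\<^sub>e q \<bullet>\<^sub>e (z - z') = 0" by simp
    then have "q \<bullet>\<^sub>e (z - z') = 0" using sq[of "z - z'"] by (simp add: q_def)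
    then have z: "q \<bullet>\<^sub>e z = q \<bullet>\<^sub>e z'" by simp
    then have "u + J \<bullet>\<^sub>e w = u' + J \<bullet>\<^sub>e w'" using eq by simp
    then show ?thesis using half_unique[OF U(1) uw] z by blast
  qed
  define K0 where "K0 v = (THE k. \<exists>u w z. D v u w z \<and> k = I \<bullet>\<^sub>e u + J \<bullet>\<^sub>e I \<bullet>\<^sub>e w)" for v
  have K0: "K0 v = I \<bullet>\<^sub>e u + J \<bullet>\<^sub>e I \<bullet>\<^sub>e w" if "D v u w z" for v u w z
    unfolding K0_def using that D_unique by (intro the_equality) blast+
  have D_add: "D (v + v') (u + u') (w + w') (z + z')" if "D v u w z" "D v' u' w' z'" for v u w z v' u' w' z'
    using that sU by (auto simp: D_def subspace_add)
  have D_scale: "D (r *\<^sub>R v) (r *\<^sub>R u) (r *\<^sub>R w) (r *\<^sub>R z)" if "D v u w z" for v u w z r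
    using that sU by (auto simp: D_def subspace_scale scaleR_add_right)
  have D_I: "D (I \<bullet>\<^sub>e v) (I \<bullet>\<^sub>e u) (- (I \<bullet>\<^sub>e w)) (I \<bullet>\<^sub>e z)" if "D v u w z" for v u w z
    using that sU by (auto simp: D_def subspace_neg app_relations q_comm)
  have D_J: "D (J \<bullet>\<^sub>e v) (- w) u (J \<bullet>\<^sub>e z)" if "D v u w z" for v u w z
    using that sU by (auto simp: D_def subspace_neg app_relations q_comm)
  have D_c: "D (c \<bullet>\<^sub>e v) (c \<bullet>\<^sub>e u) (c \<bullet>\<^sub>e w) (c \<bullet>\<^sub>e z)" if "D v u w z" for v u w z
    using that U(2) by (auto simp: D_def app_relations q_comm)
  have D_K: "D (K0 v) (I \<bullet>\<^sub>e u) (I \<bullet>\<^sub>e w) 0" if "D v u w z" for v u w z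
    using that sU K0[OF that] by (auto simp: D_def)
  have "linear K0"
  proof
    fix v v' r
    obtain u w z u' w' z' where D: "D v u w z" "D v' u' w' z'" using D_ex by metis
    show "K0 (v + v') = K0 v + K0 v'"
      by (simp add: K0[OF D_add[OF D]] K0[OF D(1)] K0[OF D(2)])
    show "K0 (r *\<^sub>R v) = r *\<^sub>R K0 v"
      by (simp add: K0[OF D_scale[OF D(1)]] K0[OF D(1)] scaleR_add_right)
  qed
  define K where "K = endo K0"
  have app_K: "K \<bullet>\<^sub>e v = K0 v" for v
    unfolding K_def by (rule app_endo[OF \<open>linear K0\<close>])
  have KK: "(1 + 2 *\<^sub>R (K * K)) \<bullet>\<^sub>e v = - (u + J \<bullet>\<^sub>e w) + q \<bullet>\<^sub>e z" if "D v u w z" for v u w z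
  proof -
    have "(1 + 2 *\<^sub>R (K * K)) \<bullet>\<^sub>e v = v + 2 *\<^sub>R K0 (K0 v)" by (simp add: app_K)
    also have "K0 (K0 v) = - (u + J \<bullet>\<^sub>e w)"
      using K0[OF D_K[OF that]] by (simp add: app_relations)
    also have "v + 2 *\<^sub>R - (u + J \<bullet>\<^sub>e w) = - (u + J \<bullet>\<^sub>e w) + q \<bullet>\<^sub>e z"
      using that by (simp add: D_def scaleR_2)
    finally show ?thesis .
  qed
  have "K * K * K = - K"
  proof (rule endo_eqI)
    fix v
    obtain u w z where D: "D v u w z" using D_ex by metis
    have "(K * K * K) \<bullet>\<^sub>e v = K0 (K0 (K0 v))" by (simp add: app_K)
    also have "\<dots> = - (I \<bullet>\<^sub>e u + J \<bullet>\<^sub>e I \<bullet>\<^sub>e w)"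
      using K0[OF D_K[OF D_K[OF D]]] by (simp add: app_relations)
    finally show "(K * K * K) \<bullet>\<^sub>e v = (- K) \<bullet>\<^sub>e v"
      by (simp add: app_K K0[OF D])
  qed
  moreover have "K * I = I * K"
  proof (rule endo_eqI)
    fix v
    obtain u w z where D: "D v u w z" using D_ex by metis
    show "(K * I) \<bullet>\<^sub>e v = (I * K) \<bullet>\<^sub>e v"
      using K0[OF D_I[OF D]] K0[OF D] by (simp add: app_K app_relations)
  qed
  moreover have "K * J = J * K"
  proof (rule endo_eqI)
    fix v
    obtain u w z where D: "D v u w z" using D_ex by metis
    show "(K * J) \<bullet>\<^sub>e v = (J * K) \<bullet>\<^sub>e v"
      using K0[OF D_J[OF D]] K0[OF D] by (simp add: app_K app_relations)
  qed
  moreover have "K * c = c * K"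
  proof (rule endo_eqI)
    fix v
    obtain u w z where D: "D v u w z" using D_ex by metis
    show "(K * c) \<bullet>\<^sub>e v = (c * K) \<bullet>\<^sub>e v"
      using K0[OF D_c[OF D]] K0[OF D] by (simp add: app_K app_relations)
  qed
  moreover have "v = 0" if l: "l \<le> 0" and eig: "c \<bullet>\<^sub>e (1 + 2 *\<^sub>R (K * K)) \<bullet>\<^sub>e v = l *\<^sub>R v" for l v
  proof -
    obtain u w z where D: "D v u w z" using D_ex by metis
    have "c \<bullet>\<^sub>e (- (u + J \<bullet>\<^sub>e w) + q \<bullet>\<^sub>e z) = l *\<^sub>R v"
      using eig by (simp only: KK[OF D])
    then have "D (l *\<^sub>R v) (- (c \<bullet>\<^sub>e u)) (- (c \<bullet>\<^sub>e w)) (c \<bullet>\<^sub>e z)"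
      using D U(2) sU(1) unfolding D_def
      by (simp add: q_comm app_relations subspace_neg)
    from D_unique[OF this D_scale[OF D, of l]]
    have eqs: "c \<bullet>\<^sub>e u = - l *\<^sub>R u" "c \<bullet>\<^sub>e w = - l *\<^sub>R w" "c \<bullet>\<^sub>e q \<bullet>\<^sub>e z = l *\<^sub>R q \<bullet>\<^sub>e z"
      by (auto simp: q_comm equation_minus_iff[of "c \<bullet>\<^sub>e _"])
    (* On the generalized eigenspace q acts on an eigenvector for the nonnegative eigenvalue - l
       as a nonzero scalar, and as 0. *)
    have zero: "x = 0" if x: "x \<in> U" "c \<bullet>\<^sub>e x = - l *\<^sub>R x" for x
    proof -
      have "root_product c ms \<bullet>\<^sub>e x = (\<Prod>m\<leftarrow>ms. - l - m) *\<^sub>R x" for ms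
        using x(2) by (induction ms) (simp_all add: algebra_simps)
      moreover have "q \<bullet>\<^sub>e x = 0"
        using V_I[OF x(1) subspace_0[OF sU(1)]] by (simp add: V_def)
      moreover have "(\<Prod>m\<leftarrow>ls. - l - m) \<noteq> 0"
        using neg l by (auto simp: prod_list_zero_iff)
      ultimately show ?thesis by (simp add: q_def)
    qed
    have "q \<bullet>\<^sub>e z = 0"
      using noneg[of l z] eqs(3) l inj[of "q \<bullet>\<^sub>e z"] by (cases "l = 0") (auto simp: q_def)
    then show "v = 0"
      using D zero[of u] zero[of w] eqs by (simp add: D_def)
  qed
  ultimately show thesis by (rule that)
qed

text \<open>
  With \<open>S = exp (\<pi> K) = 1 + 2 K\<^sup>2\<close>, the operator \<open>d = c S\<close> has a logarithm \<open>L\<close> given by the integral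
  formula. \<open>L\<close> commutes with \<open>K\<close>, and \<open>S\<^sup>2 = 1\<close> gives \<open>exp (L + \<pi> K) = c S S = c\<close>.
\<close>

theorem quaternionic_log_exists:
  assumes inj: "\<And>v. c \<bullet>\<^sub>e v = 0 \<Longrightarrow> v = 0"
  obtains b where "exp b = c" "b * I = I * b" "b * J = J * b"
proof -
  obtain K where K: "K * K * K = - K" "K * I = I * K" "K * J = J * K" "K * c = c * K"
    and spec: "\<And>l v. l \<le> 0 \<Longrightarrow> c \<bullet>\<^sub>e (1 + 2 *\<^sub>R (K * K)) \<bullet>\<^sub>e v = l *\<^sub>R v \<Longrightarrow> v = 0"
    using rotation_removing_negative_spectrum[OF inj] by metis
  define S where "S = 1 + 2 *\<^sub>R (K * K)"
  define d where "d = c * S"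
  have S_comm: "x * S = S * x" if "x * K = K * x" for x
  proof -
    have "x * (K * K) = K * K * x" using that by (metis mult.assoc)
    then show ?thesis by (simp add: S_def distrib_left distrib_right)
  qed
  have d_comm: "x * d = d * x" if "x * K = K * x" "x * c = c * x" for x
    using S_comm[OF that(1)] that(2) unfolding d_def by (metis mult.assoc)
  have "\<exists>r. r * (1 + s *\<^sub>R (d - 1)) = 1 \<and> (1 + s *\<^sub>R (d - 1)) * r = 1" if s: "s \<in> {0..1}" for s
  proof -
    have "v = 0" if "(1 + s *\<^sub>R (d - 1)) \<bullet>\<^sub>e v = 0" for v
    proof (cases "s = 0")
      case False
      then have "s > 0" using s by simp
      have "s *\<^sub>R (d \<bullet>\<^sub>e v) = (s - 1) *\<^sub>R v"
        using that by (simp add: algebra_simps)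
      then have "d \<bullet>\<^sub>e v = ((s - 1) / s) *\<^sub>R v"
        using \<open>s > 0\<close> by (metis less_irrefl scaleR_cancel_left scaleR_scaleR nonzero_mult_div_cancel_left times_divide_eq_right)
      moreover have "(s - 1) / s \<le> 0" using s \<open>s > 0\<close> by (simp add: divide_nonpos_pos)
      ultimately show "v = 0" using spec unfolding d_def S_def by simp
    qed (use that in simp)
    then show ?thesis using endo_invertible_if_injective by metis
  qed
  then obtain L where L: "exp L = d" "\<And>x. x * d = d * x \<Longrightarrow> x * L = L * x"
    using log_exists_if_segment_invertible[of d] by blast
  have exp_K: "exp (pi *\<^sub>R K) = S"
    using exp_rotation[OF K(1), of pi] by (simp add: S_def)
  have "K * K * (K * K) = - (K * K)"
    using K(1) by (metis mult.assoc mult_minus_left)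
  then have "S * S = 1"
    by (simp add: S_def algebra_simps scaleR_2)
  have "K * L = L * K" using L(2)[OF d_comm[OF refl K(4)]] .
  then have "exp (L + pi *\<^sub>R K) = exp L * exp (pi *\<^sub>R K)"
    by (intro exp_add_commuting) simp
  also have "\<dots> = c"
    using \<open>S * S = 1\<close> by (simp add: L(1) exp_K d_def mult.assoc)
  finally have "exp (L + pi *\<^sub>R K) = c" .
  moreover have "I * L = L * I" "J * L = L * J"
    using L(2) d_comm K commute by metis+
  ultimately show thesis
    using K that[of "L + pi *\<^sub>R K"] by (simp add: distrib_left distrib_right)
qed

end

section \<open>Quaternionic matrices as operators\<close>

lemma bilinear_matrix_vector_mult:
  "bilinear ((*v) :: quat^'n^'m \<Rightarrow> quat^'n \<Rightarrow> quat^'m)"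
  unfolding bilinear_def
  by (auto intro!: linearI simp: vec_eq_iff matrix_vector_mult_def scaleR_sum_right
      sum.distrib distrib_left distrib_right)

lemma bilinear_matrix_matrix_mult:
  "bilinear ((**) :: quat^'n^'m \<Rightarrow> quat^'k^'n \<Rightarrow> quat^'k^'m)"
  unfolding bilinear_def
  by (auto intro!: linearI simp: vec_eq_iff matrix_matrix_mult_def scaleR_sum_right
      sum.distrib distrib_left distrib_right)

definition left_op :: "quat^'n^'n \<Rightarrow> (quat^'n) endo" where
  "left_op A = endo ((*v) A)"

definition right_op :: "quat \<Rightarrow> (quat^'n) endo" where
  "right_op q = endo (\<lambda>v. right_scale v q)"

definition matrix_of :: "(quat^'n) endo \<Rightarrow> quat^'n^'n" where
  "matrix_of f = (\<chi> i j. (f \<bullet>\<^sub>e axis j 1) $ i)"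

lemma app_left_op [simp]: "left_op A \<bullet>\<^sub>e v = A *v v"
  unfolding left_op_def using bilinear_matrix_vector_mult
  by (intro app_endo) (simp add: bilinear_def)

lemma app_right_op [simp]: "right_op q \<bullet>\<^sub>e v = right_scale v q"
  unfolding right_op_def
  by (intro app_endo linearI) (auto simp: right_scale_def vec_eq_iff distrib_right)

lemma left_op_simps:
  "left_op (A ** B) = left_op A * left_op B" "left_op (mat 1) = 1"
  "left_op (r *\<^sub>R A) = r *\<^sub>R left_op A"
proof -
  show "left_op (A ** B) = left_op A * left_op B" "left_op (mat 1) = 1"
    by (rule endo_eqI, simp add: matrix_vector_mul_assoc)+
  show "left_op (r *\<^sub>R A) = r *\<^sub>R left_op A"
    by (rule endo_eqI) (simp add: vec_eq_iff matrix_vector_mult_def scaleR_sum_right)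
qed

lemma left_op_commutes_right_op: "left_op A * right_op q = right_op q * left_op A"
  by (rule endo_eqI)
     (simp add: vec_eq_iff matrix_vector_mult_def right_scale_def sum_distrib_right mult.assoc)

lemma matrix_of_left_op [simp]: "matrix_of (left_op A) = A"
  by (simp add: matrix_of_def vec_eq_iff matrix_vector_mult_def axis_def if_distrib if_distribR
      cong: if_cong)

lemma left_op_eq_iff: "left_op A = left_op B \<longleftrightarrow> A = B"
  by (metis matrix_of_left_op)

text \<open>
  The last term uses \<open>k = i j\<close>. An operator that commutes with right multiplication by \<open>i\<close> and \<open>j\<close>
  is thus linear for all quaternions.
\<close>

lemma right_scale_expand:
  "right_scale v q = q0 q *\<^sub>R v + q1 q *\<^sub>R right_scale v (Quat 0 1 0 0)
    + q2 q *\<^sub>R right_scale v (Quat 0 0 1 0)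
    + q3 q *\<^sub>R right_scale (right_scale v (Quat 0 1 0 0)) (Quat 0 0 1 0)"
  by (simp add: right_scale_def vec_eq_iff quat_eq_iff times_quat_def plus_quat_def scaleR_quat_def)

lemma sum_right_scale_axis: "(\<Sum>j\<in>UNIV. right_scale (axis j 1) (v $ j)) = v"
  by (simp add: right_scale_def vec_eq_iff axis_def if_distrib if_distribR cong: if_cong)

text \<open>
  A right-linear operator is determined by its values on the unit vectors, the columns of
  its matrix.
\<close>

lemma left_op_matrix_of:
  assumes "f * right_op (Quat 0 1 0 0) = right_op (Quat 0 1 0 0) * f"
    and "f * right_op (Quat 0 0 1 0) = right_op (Quat 0 0 1 0) * f"
  shows "left_op (matrix_of f) = f"
proof (rule endo_eqI)
  fix v
  have ij: "f \<bullet>\<^sub>e right_scale v (Quat 0 1 0 0) = right_scale (f \<bullet>\<^sub>e v) (Quat 0 1 0 0)"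
    "f \<bullet>\<^sub>e right_scale v (Quat 0 0 1 0) = right_scale (f \<bullet>\<^sub>e v) (Quat 0 0 1 0)" for v
    using assms by (metis app_simps(1) app_right_op)+
  have f: "f \<bullet>\<^sub>e right_scale v q = right_scale (f \<bullet>\<^sub>e v) q" for v q
    by (subst (1 2) right_scale_expand) (simp add: ij)
  have "f \<bullet>\<^sub>e v = f \<bullet>\<^sub>e (\<Sum>j\<in>UNIV. right_scale (axis j 1) (v $ j))"
    by (simp add: sum_right_scale_axis)
  also have "\<dots> = (\<Sum>j\<in>UNIV. right_scale (f \<bullet>\<^sub>e axis j 1) (v $ j))"
    by (simp add: linear_sum [OF linear_app] f)
  also have "\<dots> = left_op (matrix_of f) \<bullet>\<^sub>e v"
    by (simp add: vec_eq_iff matrix_vector_mult_def matrix_of_def right_scale_def)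
  finally show "left_op (matrix_of f) \<bullet>\<^sub>e v = f \<bullet>\<^sub>e v" by simp
qed

lemma norm_axis_one: "norm (axis j 1 :: quat^'n) = 1"
proof -
  have "(norm ((axis j 1 :: quat^'n) $ i))\<^sup>2 = (if i = j then 1 else 0)" for i
    by (simp add: axis_def)
  then show ?thesis by (simp add: norm_vec_def L2_set_def)
qed

lemma bounded_linear_matrix_of: "bounded_linear (matrix_of :: (quat^'n) endo \<Rightarrow> _)"
proof (rule bounded_linear_intro)
  fix f g :: "(quat^'n) endo" and r
  show "matrix_of (f + g) = matrix_of f + matrix_of g" "matrix_of (r *\<^sub>R f) = r *\<^sub>R matrix_of f"
    by (simp_all add: matrix_of_def vec_eq_iff)
  have "norm (matrix_of f) \<le> (\<Sum>i\<in>UNIV. norm (matrix_of f $ i))"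
    unfolding norm_vec_def by (rule L2_set_le_sum) simp
  also have "\<dots> \<le> (\<Sum>i\<in>(UNIV::'n set). \<Sum>j\<in>(UNIV::'n set). norm (matrix_of f $ i $ j))"
    unfolding norm_vec_def by (intro sum_mono L2_set_le_sum) simp
  also have "\<dots> \<le> (\<Sum>i\<in>(UNIV::'n set). \<Sum>j\<in>(UNIV::'n set). norm f)"
  proof (intro sum_mono)
    fix i j :: 'n
    have "norm (matrix_of f $ i $ j) \<le> norm (f \<bullet>\<^sub>e axis j 1)"
      by (simp add: matrix_of_def Finite_Cartesian_Product.norm_nth_le)
    also have "\<dots> \<le> norm f"
      using norm_app[of f "axis j 1"] by (simp add: norm_axis_one)
    finally show "norm (matrix_of f $ i $ j) \<le> norm f" .
  qed
  finally show "norm (matrix_of f) \<le> norm f * (real CARD('n) * real CARD('n))"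
    by (simp add: mult_ac)
qed

text \<open>
  The continuous map \<open>matrix_of\<close> carries the exponential series of operators to the series of
  matrices. Its sum is recovered as an operator because \<open>exp (left_op A)\<close> still commutes with the
  right multiplications.
\<close>

lemma left_op_mexp: "left_op (mexp A) = exp (left_op A)"
proof -
  have power: "left_op (((**) A ^^ m) (mat 1)) = left_op A ^ m" for m
    by (induction m) (simp_all add: left_op_simps)
  have "(\<lambda>m. matrix_of (left_op A ^ m /\<^sub>R fact m)) sums matrix_of (exp (left_op A))"
    by (intro bounded_linear.sums [OF bounded_linear_matrix_of] exp_converges)
  moreover have "matrix_of (left_op A ^ m /\<^sub>R fact m) = ((**) A ^^ m) (mat 1) /\<^sub>R fact m" for m
    by (metis power left_op_simps(3) matrix_of_left_op)
  ultimately have "(\<lambda>m. ((**) A ^^ m) (mat 1) /\<^sub>R fact m) sums matrix_of (exp (left_op A))"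
    by simp
  then have "mexp A = matrix_of (exp (left_op A))"
    unfolding mexp_def by (rule sums_unique [symmetric])
  then show ?thesis
    by (simp add: left_op_matrix_of exp_commutes_with_commuting left_op_commutes_right_op)
qed

lemma mexp_add_scaleR: "mexp ((s + t) *\<^sub>R B) = mexp (s *\<^sub>R B) ** mexp (t *\<^sub>R B)"
proof -
  have "exp ((s + t) *\<^sub>R left_op B) = exp (s *\<^sub>R left_op B) * exp (t *\<^sub>R left_op B)"
    unfolding scaleR_add_left by (rule exp_add_commuting) (simp add: mult.commute)
  then show ?thesis
    by (simp only: left_op_eq_iff [symmetric] left_op_simps left_op_mexp)
qed

lemma mexp_zero: "mexp 0 = (mat 1 :: quat^'n^'n)"
  using left_op_simps(3)[of 0 "mat 1 :: quat^'n^'n"] unfolding left_op_eq_iff[symmetric]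
  by (simp add: left_op_mexp left_op_simps)

text \<open>
  An injective operator on a finite-dimensional real space has a two-sided inverse. The inverse
  inherits right-linearity and is therefore again a matrix.
\<close>

lemma quat_matrix_invertible_if_injective:
  fixes C :: "quat^'n^'n"
  assumes "\<And>v. C *v v = 0 \<Longrightarrow> v = 0"
  shows "C ** matrix_inv C = mat 1" "matrix_inv C ** C = mat 1"
proof -
  obtain r where r: "r * left_op C = 1" "left_op C * r = 1"
    using endo_invertible_if_injective[of "left_op C"] assms by auto
  have "r * right_op q = right_op q * r" for q
  proof -
    have "r * right_op q = r * (right_op q * left_op C) * r"
      using r(2) by (simp add: mult.assoc)
    also have "\<dots> = (r * left_op C) * right_op q * r"
      by (simp add: left_op_commutes_right_op mult.assoc)
    finally show ?thesis using r(1) by simp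
  qed
  then have "left_op (matrix_of r) = r" by (intro left_op_matrix_of)
  then have "C ** matrix_of r = mat 1 \<and> matrix_of r ** C = mat 1"
    unfolding left_op_eq_iff[symmetric] by (simp add: left_op_simps r)
  then have "C ** matrix_inv C = mat 1 \<and> matrix_inv C ** C = mat 1"
    unfolding matrix_inv_def by (rule someI)
  then show "C ** matrix_inv C = mat 1" "matrix_inv C ** C = mat 1" by auto
qed

theorem quat_matrix_log_exists:
  fixes C :: "quat^'n^'n"
  assumes inj: "\<And>v. C *v v = 0 \<Longrightarrow> v = 0"
  obtains B where "mexp B = C"
proof -
  let ?I = "right_op (Quat 0 1 0 0) :: (quat^'n) endo" and ?J = "right_op (Quat 0 0 1 0)"
  interpret quaternionic_operator ?I ?J "left_op C"
  proof
    show "?I * ?I = - 1" "?J * ?J = - 1" "?J * ?I = - (?I * ?J)"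
      by (rule endo_eqI, simp add: right_scale_def vec_eq_iff quat_eq_iff times_quat_def
          uminus_quat_def)+
  qed (rule left_op_commutes_right_op)+
  obtain b where b: "exp b = left_op C" "b * ?I = ?I * b" "b * ?J = ?J * b"
    using quaternionic_log_exists inj by auto
  then have "left_op (mexp (matrix_of b)) = left_op C"
    by (simp add: left_op_mexp left_op_matrix_of)
  then show thesis using that left_op_eq_iff by blast
qed

section \<open>Linear differential systems\<close>

text \<open>
  Gronwall's argument: if \<open>\<bar>x \<bullet> x'\<bar> \<le> C (x \<bullet> x)\<close>, then \<open>(x \<bullet> x) exp (- 2 C s)\<close> decreases and
  \<open>(x \<bullet> x) exp (2 C s)\<close> increases in \<open>s\<close>; the former settles times after the zero, the latter times
  before it.
\<close>

lemma linear_ode_unique_zero: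
  fixes x :: "real \<Rightarrow> 'x::real_inner" and A :: "real \<Rightarrow> 'e::real_normed_vector"
  assumes "bounded_bilinear act" and A: "continuous_on UNIV A"
    and x: "\<And>t. (x has_vector_derivative act (A t) (x t)) (at t)"
    and zero: "x a = 0"
  shows "x b = 0"
proof -
  interpret bounded_bilinear act by fact
  obtain K where K: "K > 0" "\<And>u v. norm (act u v) \<le> norm u * norm v * K"
    using pos_bounded by blast
  let ?S = "{min a b..max a b}"
  have "compact (A ` ?S)"
    by (intro compact_continuous_image continuous_on_subset[OF A]) auto
  then obtain k where k: "\<And>s. s \<in> ?S \<Longrightarrow> norm (A s) \<le> k"
    using compact_imp_bounded bounded_iff by (metis imageI)
  define C where "C = K * k"
  have bound: "\<bar>x s \<bullet> act (A s) (x s)\<bar> \<le> C * (x s \<bullet> x s)" if "s \<in> ?S" for s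
  proof -
    have "\<bar>x s \<bullet> act (A s) (x s)\<bar> \<le> norm (x s) * norm (act (A s) (x s))"
      by (rule Cauchy_Schwarz_ineq2)
    also have "\<dots> \<le> norm (x s) * (norm (A s) * norm (x s) * K)"
      by (intro mult_left_mono K) simp
    also have "\<dots> \<le> norm (x s) * (k * norm (x s) * K)"
      using k[OF that] K(1) by (intro mult_left_mono mult_right_mono) auto
    finally show ?thesis by (simp add: C_def dot_square_norm power2_eq_square mult_ac)
  qed
  define f where "f r s = (x s \<bullet> x s) * exp (r * s)" for r s
  have f_deriv: "(f r has_real_derivative
      (2 * (x s \<bullet> act (A s) (x s)) + r * (x s \<bullet> x s)) * exp (r * s)) (at s)" for r s
  proof -
    have "((\<lambda>s. x s \<bullet> x s) has_real_derivative 2 * (x s \<bullet> act (A s) (x s))) (at s)"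
      unfolding has_field_derivative_def
      by (rule has_derivative_eq_rhs,
          rule has_derivative_inner[OF x[unfolded has_vector_derivative_def]
            x[unfolded has_vector_derivative_def]])
        (simp add: fun_eq_iff inner_commute)
    then show ?thesis
      unfolding f_def by (auto intro!: derivative_eq_intros simp: algebra_simps)
  qed
  have "x b \<bullet> x b \<le> 0"
  proof (cases "a \<le> b")
    case True
    have "f (- 2 * C) b \<le> f (- 2 * C) a"
    proof (rule DERIV_nonpos_imp_nonincreasing[OF True])
      fix s assume "a \<le> s" "s \<le> b"
      then show "\<exists>y. (f (- 2 * C) has_real_derivative y) (at s) \<and> y \<le> 0"
        using f_deriv[of "- 2 * C" s] bound[of s] by (force intro: mult_nonpos_nonneg)
    qed
    then show ?thesis by (simp add: f_def zero mult_le_0_iff)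
  next
    case False
    then have "b \<le> a" by simp
    then have "f (2 * C) b \<le> f (2 * C) a"
    proof (rule DERIV_nonneg_imp_nondecreasing)
      fix s assume "b \<le> s" "s \<le> a"
      then show "\<exists>y. (f (2 * C) has_real_derivative y) (at s) \<and> y \<ge> 0"
        using f_deriv[of "2 * C" s] bound[of s] by (force intro: mult_nonneg_nonneg)
    qed
    then show ?thesis by (simp add: f_def zero mult_le_0_iff)
  qed
  then show "x b = 0" by (metis inner_eq_zero_iff inner_ge_zero order_antisym)
qed

text \<open>
  Independence of the columns is required of them as functions of time. Uniqueness of solutions
  transfers it to each single time.
\<close>

lemma fundamental_matrix_injective:
  fixes A M :: "real \<Rightarrow> quat^'n^'n"
  assumes A: "continuous_on UNIV A" and M: "fundamental_matrix A M" and v: "M t *v v = 0"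
  shows "v = 0"
proof -
  have "bounded_linear (\<lambda>X. X *v v)" for v :: "quat^'n"
    using bilinear_matrix_vector_mult by (auto simp: bilinear_def linear_conv_bounded_linear)
  then have "((\<lambda>s. M s *v v) has_vector_derivative (A s ** M s) *v v) (at s)" for s
    using M by (rule_tac bounded_linear.has_vector_derivative) (auto simp: fundamental_matrix_def)
  then have "((\<lambda>s. M s *v v) has_vector_derivative A s *v (M s *v v)) (at s)" for s
    by (simp add: matrix_vector_mul_assoc)
  then have "M s *v v = 0" for s
    using linear_ode_unique_zero[of "(*v)" A "\<lambda>s. M s *v v" t s] A v bilinear_matrix_vector_mult
    by (simp add: bilinear_conv_bounded_bilinear)
  moreover have "(\<Sum>j\<in>UNIV. right_scale (column j (M s)) (v $ j)) = M s *v v" for s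
    by (simp add: vec_eq_iff right_scale_def column_def matrix_vector_mult_def)
  ultimately have "v $ j = 0" for j
    using M unfolding fundamental_matrix_def right_lin_indep_def by metis
  then show "v = 0" by (simp add: vec_eq_iff)
qed

section \<open>Floquet's theorem\<close>

theorem theorem4p1:
  fixes A M :: "real \<Rightarrow> quat^'n^'n" and T :: real
  assumes "T > 0"
    and "continuous_on UNIV A"
    and "\<And>t. A (t + T) = A t"
    and "fundamental_matrix A M"
  shows "(\<forall>t. M (t + T) = M t ** matrix_inv (M 0) ** M T) \<and>
    (\<exists>(P :: real \<Rightarrow> quat^'n^'n) (B :: quat^'n^'n). (\<forall>t. P (t + T) = P t) \<and>
      (\<forall>t. M t = P t ** mexp (t *\<^sub>R B)) \<and>
      mexp (T *\<^sub>R B) = matrix_inv (M 0) ** M T)"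
proof -
  note inj = fundamental_matrix_injective[OF assms(2,4)]
  note inv = quat_matrix_invertible_if_injective[of "M _", OF inj]
  have deriv: "(M has_vector_derivative A t ** M t) (at t)" for t
    using assms(4) by (simp add: fundamental_matrix_def)
  define C where "C = matrix_inv (M 0) ** M T"
  have blM: "bounded_linear (\<lambda>X. X ** C)"
    using bilinear_matrix_matrix_mult by (auto simp: bilinear_def linear_conv_bounded_linear)
  have bb: "bounded_bilinear ((**) :: quat^'n^'n \<Rightarrow> quat^'n^'n \<Rightarrow> quat^'n^'n)"
    using bilinear_matrix_matrix_mult by (simp add: bilinear_conv_bounded_bilinear)
  define D where "D t = M (t + T) - M t ** C" for t
  have "(D has_vector_derivative A t ** D t) (at t)" for t
  proof -
    have "((\<lambda>t. t + T) has_vector_derivative 1) (at t)"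
      by (auto intro!: derivative_eq_intros)
    from vector_diff_chain_at[OF this deriv]
    have "((\<lambda>t. M (t + T)) has_vector_derivative A t ** M (t + T)) (at t)"
      by (simp add: o_def assms(3))
    moreover have "((\<lambda>t. M t ** C) has_vector_derivative (A t ** M t) ** C) (at t)"
      by (rule bounded_linear.has_vector_derivative[OF blM deriv])
    ultimately have "(D has_vector_derivative A t ** M (t + T) - (A t ** M t) ** C) (at t)"
      unfolding D_def by (rule has_vector_derivative_diff)
    then show ?thesis
      by (simp add: D_def bounded_bilinear.diff_right[OF bb] matrix_mul_assoc)
  qed
  moreover have "D 0 = 0"
    by (simp add: D_def C_def matrix_mul_assoc inv(1))
  ultimately have "D t = 0" for t
    using linear_ode_unique_zero[OF bb assms(2)] by blast
  then have period: "M (t + T) = M t ** C" for t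
    by (simp add: D_def)
  have "v = 0" if "C *v v = 0" for v
  proof -
    have "M 0 *v (C *v v) = M T *v v"
      by (simp add: C_def matrix_vector_mul_assoc matrix_mul_assoc inv(1))
    then show "v = 0" using that inj[of T v] by simp
  qed
  then obtain B0 where B0: "mexp B0 = C"
    using quat_matrix_log_exists by blast
  define B where "B = B0 /\<^sub>R T"
  have B: "mexp (T *\<^sub>R B) = C"
    using assms(1) by (simp add: B_def B0)
  define P where "P t = M t ** mexp ((- t) *\<^sub>R B)" for t
  have "P (t + T) = P t" for t
  proof -
    (* C = exp (T B) absorbs the extra factor exp (- T B). *)
    have "C ** mexp ((- (t + T)) *\<^sub>R B) = mexp ((- t) *\<^sub>R B)"
      unfolding B[symmetric] mexp_add_scaleR[symmetric] by simp
    then show ?thesis by (simp add: P_def period matrix_mul_assoc[symmetric])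
  qed
  moreover have "M t = P t ** mexp (t *\<^sub>R B)" for t
    using mexp_add_scaleR[of "- t" t B, symmetric]
    by (simp add: P_def matrix_mul_assoc[symmetric] mexp_zero)
  ultimately show ?thesis
    using period B unfolding C_def matrix_mul_assoc by blast
qed

end
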